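(* Let $b\in\mathbb{R}$ with $b\neq 0$, let $f\colon\mathbb{R}\times\mathbb{R}\to\mathbb{R}$ be continuous, and let $$g\colon\mathbb{R}\to\mathbb{R},\quad v\mapsto v\sin\big(\ln(1+|v|)\big).$$ Define $G\colon\mathbb{R}^3\to\mathbb{R}$ by $G(\rho,\xi,v):=f(\rho,\xi)+b\,g(v)$. Then the system $\dot x(t)=G(p(t),x(t),u(t))$, $x(0)=x^0$, has non-unique control direction; that is, both $\eta=-1$ and $\eta=+1$ are control directions for this system.
   Context: Control direction: for continuous $G\colon\mathbb{R}^3\to\mathbb{R}$, a number $\eta\in\{-1,+1\}$ is a control direction for the system $\dot x(t)=G(p(t),x(t),u(t))$ if, for every nonempty compact $K\subset\mathbb{R}\times\mathbb{R}$, there exists $v^*\in(0,1)$ such that the function $$\chi\colon\mathbb{R}\to\mathbb{R},\quad s\mapsto\min\{vG(\rho,\xi,sv)\mid(\rho,\xi)\in K,\ v\in\mathbb{R},\ v^*\le|v|\le 1\}$$ has the property $\sup_{s\ge 0}\chi(\eta s)=+\infty$. *)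

theory Defs
  imports "HOL-Analysis.Analysis"
begin

(* The minimum over K and v_star <= |v| <= 1 is rendered literally, as the least element of the
   set of values.  It is attained for continuous G, nonempty compact K and 0 < v_star < 1. *)
definition control_chi ::
    "(real \<times> real \<times> real \<Rightarrow> real) \<Rightarrow> (real \<times> real) set \<Rightarrow> real \<Rightarrow> real \<Rightarrow> real" where
  "control_chi G K v_star s =
     (LEAST m. m \<in> {v * G (\<rho>, \<xi>, s * v) | \<rho> \<xi> v. (\<rho>, \<xi>) \<in> K \<and> v_star \<le> \<bar>v\<bar> \<and> \<bar>v\<bar> \<le> 1})"

(* The system x'(t) = G (p t, x t, u t) enters only through its right-hand side G; the
   supremum is taken in the extended reals. *)
definition control_direction :: "(real \<times> real \<times> real \<Rightarrow> real) \<Rightarrow> real \<Rightarrow> bool" where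
  "control_direction G \<eta> \<longleftrightarrow>
     continuous_on UNIV G \<and> \<eta> \<in> {-1, 1} \<and>
     (\<forall>K. compact K \<and> K \<noteq> {} \<longrightarrow>
        (\<exists>v_star. 0 < v_star \<and> v_star < 1 \<and>
           (SUP s\<in>{0..}. ereal (control_chi G K v_star (\<eta> * s))) = \<infinity>))"

definition nonunique_control_direction :: "(real \<times> real \<times> real \<Rightarrow> real) \<Rightarrow> bool" where
  "nonunique_control_direction G \<longleftrightarrow> control_direction G (-1) \<and> control_direction G 1"

end

(* Along the amplitudes t with ln (1 + t) = pi/2 + 2 pi n (or 3 pi/2 + 2 pi n), the point
   ln (1 + t |v|) stays within distance ln 2 < pi/3 of ln (1 + t) for all 1/2 <= |v| <= 1.  Hence
   sin (ln (1 + t |v|)) has a fixed sign and modulus at least 1/2 there, and the oscillating term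
   b s v^2 sin (ln (1 + |s v|)) of v G(rho, xi, s v), s = eta t, is at least |b| t / 8, whereas
   v f(rho, xi) is bounded on K.  Either sign of b * eta is served by one of the two sequences. *)

theory Submission
  imports Defs
begin

text \<open>\<open>LEAST\<close> says something only once a least element is known to exist. Here it
  comes from a continuous function on a compact product; \<open>w \<le> 1\<close> puts 1 among the
  admissible \<open>v\<close>, so the product is nonempty. Lower bounds on
  \<open>control_chi\<close> then reduce to evaluation at one minimiser.\<close>

lemma control_chi_attained:
  fixes G :: "real \<times> real \<times> real \<Rightarrow> real"
  assumes G: "continuous_on UNIV G" and K: "compact K" "K \<noteq> {}" and w: "w \<le> 1"
  shows "\<exists>\<rho> \<xi> v. (\<rho>, \<xi>) \<in> K \<and> w \<le> \<bar>v\<bar> \<and> \<bar>v\<bar> \<le> 1 \<and>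
           control_chi G K w s = v * G (\<rho>, \<xi>, s * v)"
proof -
  define V where "V = {v::real. w \<le> \<bar>v\<bar> \<and> \<bar>v\<bar> \<le> 1}"
  define h where "h = (\<lambda>q::(real \<times> real) \<times> real. snd q * G (fst (fst q), snd (fst q), s * snd q))"
  have "V = {-1..1} \<inter> {v. w \<le> \<bar>v\<bar>}"
    unfolding V_def by auto
  moreover have "closed {v::real. w \<le> \<bar>v\<bar>}"
    by (intro closed_Collect_le continuous_intros)
  ultimately have "compact V"
    by (simp add: compact_Int_closed)
  then have "compact (K \<times> V)"
    using K by (intro compact_Times)
  moreover have "1 \<in> V"
    using w by (simp add: V_def)
  then have "K \<times> V \<noteq> {}"
    using K by auto
  moreover have "continuous_on (K \<times> V) h"
    unfolding h_def
    by (intro continuous_intros continuous_on_compose2[OF G]) auto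
  ultimately obtain q where q: "q \<in> K \<times> V" and le: "\<And>r. r \<in> K \<times> V \<Longrightarrow> h q \<le> h r"
    using continuous_attains_inf by metis
  obtain \<rho> \<xi> v where qe: "q = ((\<rho>, \<xi>), v)"
    by (metis prod.exhaust)
  have "control_chi G K w s = h q"
    unfolding control_chi_def
  proof (rule Least_equality)
    show "h q \<in> {v * G (\<rho>, \<xi>, s * v) |\<rho> \<xi> v. (\<rho>, \<xi>) \<in> K \<and> w \<le> \<bar>v\<bar> \<and> \<bar>v\<bar> \<le> 1}"
      using q unfolding qe h_def V_def by auto
  next
    fix y
    assume "y \<in> {v * G (\<rho>, \<xi>, s * v) |\<rho> \<xi> v. (\<rho>, \<xi>) \<in> K \<and> w \<le> \<bar>v\<bar> \<and> \<bar>v\<bar> \<le> 1}"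
    then obtain \<rho>' \<xi>' v' where "(\<rho>', \<xi>') \<in> K" "w \<le> \<bar>v'\<bar>" "\<bar>v'\<bar> \<le> 1"
      "y = v' * G (\<rho>', \<xi>', s * v')"
      by auto
    then show "h q \<le> y"
      using le[of "((\<rho>', \<xi>'), v')"] by (simp add: h_def V_def)
  qed
  then show ?thesis
    using q unfolding qe h_def V_def by auto
qed

lemma cos_ge_half_of_le_one:
  fixes d :: real
  assumes "0 \<le> d" "d \<le> 1"
  shows "1 / 2 \<le> cos d"
proof -
  have "d \<le> pi / 3"
    using pi_gt3 assms by linarith
  then have "cos (pi / 3) \<le> cos d"
    using assms by (intro cos_monotone_0_pi_le) auto
  then show ?thesis
    by (simp add: cos_60)
qed

text \<open>Since \<open>(1 + t) / 2 \<le> 1 + t * u\<close>, the logarithm drops by at most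
  \<open>ln 2\<close>. Rounding this up to 1 still stays below \<open>pi / 3\<close>.\<close>

lemma ln_one_plus_mult_bounds:
  fixes t u :: real
  assumes "0 \<le> t" "1 / 2 \<le> u" "u \<le> 1"
  shows "ln (1 + t) - 1 \<le> ln (1 + t * u)" "ln (1 + t * u) \<le> ln (1 + t)"
proof -
  have tu: "t * (1 / 2) \<le> t * u" "t * u \<le> t"
    using assms by (intro mult_left_mono mult_left_le; simp)+
  then show "ln (1 + t * u) \<le> ln (1 + t)"
    using assms by (subst ln_le_cancel_iff) auto
  have "ln (1 + t) - ln 2 = ln ((1 + t) / 2)"
    using assms by (simp add: ln_div)
  also have "\<dots> \<le> ln (1 + t * u)"
    using assms(1) tu(1) by (subst ln_le_cancel_iff) (auto intro!: add_pos_nonneg simp: field_simps)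
  finally show "ln (1 + t) - 1 \<le> ln (1 + t * u)"
    using ln_2_less_1 by linarith
qed

lemma ex_large_amplitude_sin_ln:
  fixes \<sigma> T :: real
  assumes \<sigma>: "\<sigma> = 1 \<or> \<sigma> = -1"
  shows "\<exists>t\<ge>0. T \<le> t \<and> (\<forall>u. 1 / 2 \<le> u \<and> u \<le> 1 \<longrightarrow> 1 / 2 \<le> \<sigma> * sin (ln (1 + t * u)))"
proof -
  define \<phi> where "\<phi> = (if \<sigma> = 1 then pi / 2 else 3 * pi / 2)"
  have \<phi>: "0 \<le> \<phi>" "sin \<phi> = \<sigma>" "cos \<phi> = 0"
    using \<sigma> sin_3over2_pi cos_3over2_pi by (auto simp: \<phi>_def)
  obtain n :: nat where n: "T \<le> real n"
    using real_arch_simple by blast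
  define \<theta> where "\<theta> = \<phi> + 2 * pi * real n"
  \<comment> \<open>Together with \<open>exp \<theta> - 1 \<ge> \<theta>\<close>, this pushes the
    amplitude \<open>t\<close> beyond \<open>T\<close>.\<close>
  have "real n \<le> \<theta>"
    using \<phi>(1) pi_gt3 mult_right_mono[of 1 "2 * pi" "real n"] by (simp add: \<theta>_def)
  define t where "t = exp \<theta> - 1"
  have t: "0 \<le> t" "T \<le> t" "ln (1 + t) = \<theta>"
    using \<open>real n \<le> \<theta>\<close> n exp_ge_add_one_self[of \<theta>] unfolding t_def
    by (linarith, linarith, simp)
  have "1 / 2 \<le> \<sigma> * sin (ln (1 + t * u))" if u: "1 / 2 \<le> u" "u \<le> 1" for u
  proof -
    define d where "d = \<theta> - ln (1 + t * u)"
    have d: "0 \<le> d" "d \<le> 1"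
      using ln_one_plus_mult_bounds[OF t(1) u] t(3) by (auto simp: d_def)
    have "sin \<theta> = \<sigma>" "cos \<theta> = 0"
      using \<phi> sin.plus_of_nat[of \<phi> n] cos.plus_of_nat[of \<phi> n]
      by (auto simp: \<theta>_def mult.commute)
    \<comment> \<open>At the extremum \<open>\<theta>\<close> of the sine the cosine vanishes, so
      only one term of the subtraction formula survives; the factor \<open>\<sigma>\<close> then
      cancels because its square is 1.\<close>
    then have "sin (ln (1 + t * u)) = \<sigma> * cos d"
      using sin_diff[of \<theta> d] by (simp add: d_def)
    then show ?thesis
      using cos_ge_half_of_le_one[OF d] \<sigma> by auto
  qed
  then show ?thesis
    using t by blast
qed

lemma control_direction_oscillating:
  fixes G :: "real \<times> real \<times> real \<Rightarrow> real"
  assumes b: "b \<noteq> 0" and f: "continuous_on UNIV f" and \<eta>: "\<eta> \<in> {-1, 1}"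
    and G: "\<And>\<rho> \<xi> v. G (\<rho>, \<xi>, v) = f (\<rho>, \<xi>) + b * (v * sin (ln (1 + \<bar>v\<bar>)))"
  shows "control_direction G \<eta>"
  unfolding control_direction_def
proof (intro conjI allI impI \<eta>)
  have "G = (\<lambda>q. f (fst q, fst (snd q)) +
      b * (snd (snd q) * sin (ln (1 + \<bar>snd (snd q)\<bar>))))"
    using G by auto
  \<comment> \<open>This is the side condition for continuity of \<open>ln\<close>.\<close>
  moreover have "1 + \<bar>v\<bar> \<noteq> 0" for v :: real
    by linarith
  ultimately show contG: "continuous_on UNIV G"
    by (auto intro!: continuous_intros continuous_on_compose2[OF f])
  fix K :: "(real \<times> real) set"
  assume K: "compact K \<and> K \<noteq> {}"
  then have "compact (f ` K)"
    using f by (auto intro: compact_continuous_image continuous_on_subset)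
  then have "\<exists>M. \<forall>x\<in>K. \<bar>f x\<bar> \<le> M"
    by (auto dest!: compact_imp_bounded simp: bounded_iff)
  then obtain M where M: "\<And>x. x \<in> K \<Longrightarrow> \<bar>f x\<bar> \<le> M"
    by blast
  \<comment> \<open>Absorbing both signs into \<open>\<sigma>\<close> lets a single argument cover
    both values of \<open>\<eta>\<close>.\<close>
  define \<sigma> where "\<sigma> = sgn (b * \<eta>)"
  have \<sigma>: "\<sigma> = 1 \<or> \<sigma> = -1" and b\<eta>: "b * \<eta> = \<bar>b\<bar> * \<sigma>"
    using b \<eta> by (auto simp: \<sigma>_def sgn_mult sgn_if)
  have "(SUP s\<in>{0..}. ereal (control_chi G K (1 / 2) (\<eta> * s))) = \<infinity>"
  proof (rule SUP_PInfty)
    fix n :: nat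
    \<comment> \<open>The 8 is the inverse of 1/4 (from \<open>v * v\<close>) times 1/2 (from the
      sine); the summand \<open>M\<close> pays for \<open>v * f (\<rho>, \<xi>)\<close>.\<close>
    obtain t where t: "0 \<le> t" "8 * (real n + M) / \<bar>b\<bar> \<le> t"
      and sin_ge: "\<And>u. 1 / 2 \<le> u \<Longrightarrow> u \<le> 1 \<Longrightarrow> 1 / 2 \<le> \<sigma> * sin (ln (1 + t * u))"
      using ex_large_amplitude_sin_ln[OF \<sigma>] by metis
    have bt: "real n + M \<le> \<bar>b\<bar> * t * (1 / 8)"
      using t(2) b by (simp add: field_simps)
    \<comment> \<open>The minimiser depends on \<open>t\<close> in an unknown way, which is why
      \<open>sin_ge\<close> has to hold for the whole range of \<open>u\<close>; it is applied at
      \<open>\<bar>v\<bar>\<close>.\<close>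
    obtain \<rho> \<xi> v where v: "(\<rho>, \<xi>) \<in> K" "1 / 2 \<le> \<bar>v\<bar>" "\<bar>v\<bar> \<le> 1"
      and chi: "control_chi G K (1 / 2) (\<eta> * t) = v * G (\<rho>, \<xi>, \<eta> * t * v)"
      using control_chi_attained[OF contG, of K "1 / 2" "\<eta> * t"] K by auto
    have "(1 / 2) * (1 / 2) \<le> \<bar>v\<bar> * \<bar>v\<bar>"
      using v by (intro mult_mono) auto
    then have "1 / 4 * (1 / 2) \<le> v * v * (\<sigma> * sin (ln (1 + t * \<bar>v\<bar>)))"
      using sin_ge[OF v(2,3)] by (intro mult_mono) auto
    then have "\<bar>b\<bar> * t * (1 / 8) \<le> \<bar>b\<bar> * t * (v * v * (\<sigma> * sin (ln (1 + t * \<bar>v\<bar>))))"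
      using t by (intro mult_left_mono) auto
    moreover have "\<bar>v * f (\<rho>, \<xi>)\<bar> \<le> 1 * M"
      unfolding abs_mult using v M[OF v(1)] by (intro mult_mono) auto
    moreover have "\<bar>\<eta> * t * v\<bar> = t * \<bar>v\<bar>"
      using \<eta> t by (auto simp: abs_mult)
    \<comment> \<open>The outer factor \<open>v\<close> meets the \<open>v\<close> inside
      \<open>g\<close>, so the oscillating term carries a square and the sign of \<open>v\<close>
      does not matter.\<close>
    then have "v * G (\<rho>, \<xi>, \<eta> * t * v) =
        v * f (\<rho>, \<xi>) + (b * \<eta>) * t * (v * v * sin (ln (1 + t * \<bar>v\<bar>)))"
      by (simp add: G algebra_simps)
    ultimately have "real n \<le> control_chi G K (1 / 2) (\<eta> * t)"
      using bt unfolding chi b\<eta> by (simp add: algebra_simps)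
    then show "\<exists>s\<in>{0..}. ereal (real n) \<le> ereal (control_chi G K (1 / 2) (\<eta> * s))"
      using t(1) by auto
  qed
  then show "\<exists>v_star. 0 < v_star \<and> v_star < 1 \<and>
      (SUP s\<in>{0..}. ereal (control_chi G K v_star (\<eta> * s))) = \<infinity>"
    by (intro exI[of _ "1 / 2"]) simp
qed

theorem proposition3p1:
  fixes b :: real
    and f :: "real \<times> real \<Rightarrow> real"
    and g :: "real \<Rightarrow> real"
    and G :: "real \<times> real \<times> real \<Rightarrow> real"
  assumes "b \<noteq> 0"
    and "continuous_on UNIV f"
    and "\<And>v. g v = v * sin (ln (1 + \<bar>v\<bar>))"
    and "\<And>\<rho> \<xi> v. G (\<rho>, \<xi>, v) = f (\<rho>, \<xi>) + b * g v"
  shows "nonunique_control_direction G"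
  unfolding nonunique_control_direction_def
  using assms by (auto intro!: control_direction_oscillating)

end
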